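(* There is a graph $G$ with $\chi(G)=4$ and $R_{\chi}(G)=11$.
   Context: All graphs are finite and simple. $\chi(G)$ is the chromatic number of $G$. A copy of $G$ is a graph obtained by relabeling the vertices of $G$; copies are sought as (not necessarily induced) subgraphs. For a graph $G$ containing at least one edge, the chromatic Ramsey number $R_{\chi}(G)$ is the smallest integer $N$ such that there exists a graph $F$ with $\chi(F)=N$ for which every $2$-coloring of the edges of $F$ results in a monochromatic copy of $G$. *)

theory Defs
  imports "HOL-Library.Ramsey"
begin

record 'a ugraph =
  verts :: "'a set"
  edges :: "'a set set"

definition finite_simple_graph :: "'a ugraph \<Rightarrow> bool" where
  "finite_simple_graph G \<longleftrightarrow> finite (verts G) \<and> edges G \<subseteq> [verts G]\<^bsup>2\<^esup>"

definition proper_coloring :: "'a ugraph \<Rightarrow> nat \<Rightarrow> ('a \<Rightarrow> nat) \<Rightarrow> bool" where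
  "proper_coloring G k f \<longleftrightarrow>
     f ` verts G \<subseteq> {..<k} \<and> (\<forall>u v. {u, v} \<in> edges G \<longrightarrow> f u \<noteq> f v)"

(* Inf on nat is the least element of a nonempty set and 0 on the empty set. *)
definition chromatic_number :: "'a ugraph \<Rightarrow> nat" where
  "chromatic_number G = Inf {k. \<exists>f. proper_coloring G k f}"

definition copy_of :: "'a ugraph \<Rightarrow> 'b ugraph \<Rightarrow> bool" where
  "copy_of G H \<longleftrightarrow>
     (\<exists>f. inj_on f (verts G) \<and> verts H = f ` verts G \<and> edges H = (\<lambda>e. f ` e) ` edges G)"

definition subgraph_of :: "'a ugraph \<Rightarrow> 'a ugraph \<Rightarrow> bool" where
  "subgraph_of H F \<longleftrightarrow> verts H \<subseteq> verts F \<and> edges H \<subseteq> edges F"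

definition monochromatic :: "('a set \<Rightarrow> bool) \<Rightarrow> 'a ugraph \<Rightarrow> bool" where
  "monochromatic c H \<longleftrightarrow> (\<exists>b. \<forall>e\<in>edges H. c e = b)"

(* An edge colouring is a total function on vertex sets; only its values on the edges of F
   matter. *)
definition ramsey_arrows :: "'b ugraph \<Rightarrow> 'a ugraph \<Rightarrow> bool" where
  "ramsey_arrows F G \<longleftrightarrow>
     (\<forall>c :: 'b set \<Rightarrow> bool. \<exists>H. copy_of G H \<and> subgraph_of H F \<and> monochromatic c H)"

(* F may be taken on the vertex type nat, since every finite graph is isomorphic to such a graph.
   If no F existed, the infimum would be 0; in particular, a positive value is attained. The notion
   is intended for finite simple G with at least one edge. *)
definition chromatic_ramsey_number :: "'a ugraph \<Rightarrow> nat" where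
  "chromatic_ramsey_number G =
     Inf {N. \<exists>F :: nat ugraph. finite_simple_graph F \<and> chromatic_number F = N \<and> ramsey_arrows F G}"

end

theory Submission
  imports Defs "HOL-Library.Nat_Bijection"
begin

text \<open>
  Everything is measured by the circular clique \<open>K\<close> on \<open>{0..9}\<close> whose edges join residues at circular
  distance at least 3.  The complement of \<open>K\<close> maps into \<open>K\<close> by \<open>x \<mapsto> 3x\<close>, so \<open>K\<^sub>1\<^sub>0\<close> has a 2-colouring both of
  whose classes map to \<open>K\<close>, and \<open>R\<^sub>\<chi>(G) \<ge> 11\<close> whenever \<open>G\<close> has no homomorphism to \<open>K\<close>.  Conversely, in any
  2-colouring of \<open>K\<^sub>1\<^sub>1\<close> one class does not map to \<open>K\<close>: otherwise some three consecutive residues pull back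
  to four vertices independent in the first class, hence a 4-clique of the second, while \<open>K\<close> has no
  4-clique.  Let \<open>G\<close> be the product of one such class per 2-colouring with \<open>K\<^sub>4\<close>.  As \<open>K\<close> is multiplicative
  (Tardif), \<open>G\<close> does not map to \<open>K\<close>, so \<open>\<chi>(G) = 4\<close>; and \<open>G\<close> maps to a colour class of every
  2-colouring of \<open>K\<^sub>1\<^sub>1\<close>, so by Ramsey's theorem a large complete 11-partite graph arrows \<open>G\<close>.

  Multiplicativity is a cocycle argument.  For \<open>f\<close> from \<open>E \<times> F\<close> to \<open>K\<close>, the descents of \<open>f\<close> attach to edges
  \<open>gg'\<close> of \<open>E\<close> and \<open>hh'\<close> of \<open>F\<close> a bit, the value \<open>eps h h' g g'\<close>.  For fixed \<open>hh'\<close>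
  this is a mod 2 cochain on \<open>E\<close>, and if it is a coboundary then \<open>E\<close> maps to \<open>K\<close>.  4-cycles of \<open>K\<close> have an
  even number of descents, so the cohomology class does not depend on \<open>hh'\<close>.  With the factors
  exchanged the bit is negated; hence if the cochain on \<open>E\<close> is odd on a closed walk, then summing over that
  walk makes \<open>F\<close> bipartite (even length) or the cochain on \<open>F\<close> a coboundary (odd length).
\<close>

section \<open>The circular clique with 10 vertices and distance 3\<close>

definition circ :: "nat \<Rightarrow> nat \<Rightarrow> bool" where
  "circ a b \<longleftrightarrow> a < 10 \<and> b < 10 \<and> (a + 3 \<le> b \<and> b \<le> a + 7 \<or> b + 3 \<le> a \<and> a \<le> b + 7)"

lemma circ_sym: "circ a b \<Longrightarrow> circ b a"
  by (auto simp: circ_def)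

lemma circ_less_asym: "circ a b \<Longrightarrow> a < b \<longleftrightarrow> \<not> b < a"
  by (auto simp: circ_def)

lemma circ_cases:
  assumes "circ a b"
  obtains "a + 3 \<le> b" "b \<le> a + 7" "b < 10" "\<not> b < a" "a < b"
    | "b + 3 \<le> a" "a \<le> b + 7" "a < 10" "\<not> a < b" "b < a"
  using assms unfolding circ_def by fastforce

text \<open>Each step has residue 3..7 modulo 10; around the cycle these sum to a multiple of 10
  between 12 and 28, so exactly two steps descend.\<close>

lemma circ_four_cycle:
  assumes "circ a b" "circ b c" "circ c d" "circ d a"
  shows "((b < a) \<noteq> (c < b)) = ((d < c) \<noteq> (a < d))"
  using assms by (elim circ_cases) simp_all

text \<open>Why a coboundary \<open>y\<close> yields a colouring: take midpoints, moved to their antipodes where \<open>y\<close> holds.\<close>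

lemma circ_midpoint:
  assumes "circ a b'" "circ b a'" "(y' \<noteq> y) = ((b' < a) \<noteq> (a' < b))"
  shows "circ (((a + b) div 2 + (if y then 5 else 0)) mod 10)
              (((a' + b') div 2 + (if y' then 5 else 0)) mod 10)"
proof -
  define s where "s = (a + b) div 2"
  define s' where "s' = (a' + b') div 2"
  have s: "2 * s \<le> a + b" "a + b \<le> 2 * s + 1" "2 * s' \<le> a' + b'" "a' + b' \<le> 2 * s' + 1"
    unfolding s_def s'_def by linarith+
  have b: "a < 10" "b < 10" "a' < 10" "b' < 10" using assms(1,2) by (auto simp: circ_def)
  have sl: "s < 10" "s' < 10" using s b by linarith+
  have m: "(x::nat) < 20 \<Longrightarrow> x mod 10 = (if x < 10 then x else x - 10)" for x 
    by (simp add: mod_if)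
  consider "b' < a" "a' < b" | "b' > a" "a' > b" | "b' < a" "a' > b" | "b' > a" "a' < b"
    using assms(1,2) by (elim circ_cases) blast+
  \<comment> \<open>Averaging two steps in the same direction keeps a length in 3..7; averaging
    opposite ones leaves at most 2, which one antipodal shift brings back into 3..7.\<close>
  then have "if y' = y then s' + 3 \<le> s \<and> s \<le> s' + 7 \<or> s + 3 \<le> s' \<and> s' \<le> s + 7
    else s' \<le> s + 2 \<and> s \<le> s' + 2"
    using assms s by cases (elim circ_cases; simp; linarith)+
  then show ?thesis using sl unfolding s_def[symmetric] s'_def[symmetric]
    by (cases y; cases y'; simp add: m circ_def; linarith)
qed

lemma circ_no_4_clique:
  assumes "circ a b" "circ a c" "circ a d" "circ b c" "circ b d" "circ c d"
  shows False
  using assms by (elim circ_cases) simp_all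

text \<open>For \<open>t < 10\<close>, the residues \<open>t\<close>, \<open>t + 1\<close>, \<open>t + 2\<close> modulo 10, phrased linearly.\<close>

definition circ_window :: "nat \<Rightarrow> nat set" where
  "circ_window t = {x. t \<le> x \<and> x \<le> t + 2 \<or> x + 8 \<le> t}"

lemma circ_window_independent:
  assumes "t < 10" "u \<in> circ_window t" "v \<in> circ_window t"
  shows "\<not> circ u v"
proof
  assume "circ u v"
  then show False using assms unfolding circ_window_def by (elim circ_cases) auto
qed

lemma circ_times_3:
  assumes "a < 10" "b < 10" "a \<noteq> b" "\<not> circ a b"
  shows "circ (3 * a mod 10) (3 * b mod 10)"
proof -
  have "\<forall>a<10. \<forall>b<10. a \<noteq> b \<longrightarrow> \<not> circ a b \<longrightarrow> circ (3 * a mod 10) (3 * b mod 10)"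
    by code_simp
  then show ?thesis using assms by blast
qed

lemma sum_circ_window:
  assumes "x < 10"
  shows "(\<Sum>t<10. of_bool (x \<in> circ_window t)) = (3 :: nat)"
proof -
  have "\<forall>x<(10::nat). (\<Sum>t<10. of_bool (t \<le> x \<and> x \<le> t + 2 \<or> x + 8 \<le> t)) = (3 :: nat)"
    by code_simp
  then show ?thesis using assms by (simp add: circ_window_def)
qed

section \<open>Multiplicativity\<close>

locale circ_product =
  fixes E :: "'a \<Rightarrow> 'a \<Rightarrow> bool" and F :: "'b \<Rightarrow> 'b \<Rightarrow> bool" and f :: "'a \<Rightarrow> 'b \<Rightarrow> nat"
  assumes symE: "E g g' \<Longrightarrow> E g' g" and symF: "F h h' \<Longrightarrow> F h' h"
    and circ: "E g g' \<Longrightarrow> F h h' \<Longrightarrow> circ (f g h) (f g' h')"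
begin

text \<open>Compares the descents of the two edges of the product over \<open>g g'\<close> and
  \<open>h h'\<close>; exchanging the factors reverses just one of them.\<close>

definition eps :: "'b \<Rightarrow> 'b \<Rightarrow> 'a \<Rightarrow> 'a \<Rightarrow> bool" where
  "eps h h' g g' \<longleftrightarrow> (f g' h' < f g h) \<noteq> (f g' h < f g h')"

lemma eps_commute: "eps h h' g g' = eps h' h g g'"
  by (auto simp: eps_def)

lemma swapped: "circ_product F E (\<lambda>h g. f g h)"
  by unfold_locales (auto intro: symE symF circ)

lemma eps_swapped:
  assumes "E g g'" "F h h'"
  shows "circ_product.eps (\<lambda>h g. f g h) g g' h h' = (\<not> eps h h' g g')"
  using circ_less_asym[OF circ[OF assms(1) symF[OF assms(2)]]]
  by (auto simp: eps_def circ_product.eps_def[OF swapped])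

lemma eps_adjacent:
  assumes "F h h'" "F h h''"
  shows "\<exists>q :: 'a \<Rightarrow> bool. \<forall>g g'. E g g' \<longrightarrow> (eps h h' g g' \<noteq> eps h h'' g g') = (q g \<noteq> q g')"
proof -
  \<comment> \<open>Parity of the descents from \<open>(g, h')\<close> via \<open>(g', h)\<close> to
    \<open>(g, h'')\<close>; two choices of \<open>g'\<close> close up to a 4-cycle, so it depends
    on \<open>g\<close> only.\<close>
  define r where "r g g' \<longleftrightarrow> (f g' h < f g h') \<noteq> (f g h'' < f g' h)" for g g'
  have r: "r g g' = r g k" if "E g g'" "E g k" for g g' k
    using circ_four_cycle[of "f g h'" "f g' h" "f g h''" "f k h"] circ assms that symE symF
      circ_less_asym[of "f g h''" "f k h"] circ_less_asym[of "f k h" "f g h'"]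
    unfolding r_def by metis
  define q where "q g \<longleftrightarrow> (\<exists>g'. E g g' \<and> r g g')" for g
  have q: "q g = r g g'" if "E g g'" for g g'
    using r that unfolding q_def by blast
  have "(eps h h' g g' \<noteq> eps h h'' g g') = (q g \<noteq> q g')" if e: "E g g'" for g g'
    using q[OF e] q[OF symE[OF e]]
      circ_less_asym[OF circ[OF e assms(1)]] circ_less_asym[OF circ[OF e assms(2)]]
      circ_less_asym[OF circ[OF e symF[OF assms(1)]]] circ_less_asym[OF circ[OF e symF[OF assms(2)]]]
    unfolding eps_def r_def by argo
  then show ?thesis by (intro exI[of _ q] allI impI)
qed

lemma eps_connected:
  assumes "F\<^sup>*\<^sup>* h0 h" "F h0 h1" "F h h'"
  shows "\<exists>q :: 'a \<Rightarrow> bool. \<forall>g g'. E g g' \<longrightarrow> (eps h h' g g' \<noteq> eps h0 h1 g g') = (q g \<noteq> q g')"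
  using assms(1,3)
proof (induction arbitrary: h' rule: rtranclp_induct)
  case base
  then show ?case using eps_adjacent assms(2) by blast
next
  case (step h k)
  obtain q :: "'a \<Rightarrow> bool" where q: "\<And>g g'. E g g' \<Longrightarrow> (eps h k g g' \<noteq> eps h0 h1 g g') = (q g \<noteq> q g')"
    using step.IH[OF step.hyps(2)] by blast
  obtain p :: "'a \<Rightarrow> bool" where p: "\<And>g g'. E g g' \<Longrightarrow> (eps k h' g g' \<noteq> eps k h g g') = (p g \<noteq> p g')"
    using eps_adjacent[OF step.prems symF[OF step.hyps(2)]] by blast
  have "(eps k h' g g' \<noteq> eps h0 h1 g g') = ((q g \<noteq> p g) \<noteq> (q g' \<noteq> p g'))" if "E g g'" for g g'
    using q[OF that] p[OF that] eps_commute[of k h g g'] by argo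
  then show ?case by (intro exI[of _ "\<lambda>g. q g \<noteq> p g"] allI impI)
qed

lemma coloring_if_coboundary:
  fixes y :: "'a \<Rightarrow> bool"
  assumes "F h0 h1" and "\<And>g g'. E\<^sup>*\<^sup>* g0 g \<Longrightarrow> E g g' \<Longrightarrow> (y g' \<noteq> y g) = eps h0 h1 g g'"
  shows "\<exists>x. \<forall>g g'. E\<^sup>*\<^sup>* g0 g \<longrightarrow> E g g' \<longrightarrow> circ (x g) (x g')"
proof (intro exI[of _ "\<lambda>g. ((f g h0 + f g h1) div 2 + (if y g then 5 else 0)) mod 10"] allI impI)
  fix g g'
  assume e: "E\<^sup>*\<^sup>* g0 g" "E g g'"
  show "circ (((f g h0 + f g h1) div 2 + (if y g then 5 else 0)) mod 10)
             (((f g' h0 + f g' h1) div 2 + (if y g' then 5 else 0)) mod 10)"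
    using circ_midpoint[OF circ[OF e(2) assms(1)] circ[OF e(2) symF[OF assms(1)]]] assms(2)[OF e]
    unfolding eps_def by simp
qed

text \<open>\<open>n\<close> is the parity of the length of the walk, \<open>S h h'\<close> the mod 2 sum of \<open>eps h h'\<close> along it.\<close>

inductive walk :: "'a \<Rightarrow> 'a \<Rightarrow> bool \<Rightarrow> ('b \<Rightarrow> 'b \<Rightarrow> bool) \<Rightarrow> bool" for g0 where
  nil: "walk g0 g0 False (\<lambda>_ _. False)"
| step: "walk g0 g n S \<Longrightarrow> E g g' \<Longrightarrow> walk g0 g' (\<not> n) (\<lambda>h h'. S h h' \<noteq> eps h h' g g')"

lemma walk_exists: "E\<^sup>*\<^sup>* g0 g \<Longrightarrow> \<exists>n S. walk g0 g n S"
  by (induction rule: rtranclp_induct) (blast intro: walk.intros)+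

lemma walk_reachable: "walk g0 g n S \<Longrightarrow> E\<^sup>*\<^sup>* g0 g"
  by (induction rule: walk.induct) (auto intro: rtranclp.rtrancl_into_rtrancl)

text \<open>The coboundary telescopes, so passing from \<open>h0 h1\<close> to \<open>h h'\<close>
  changes the sums of two walks with common ends by the same bit.\<close>

lemma walk_edge_independent:
  fixes q :: "'a \<Rightarrow> bool"
  assumes "walk g0 g n S"
    and "\<And>g g'. E g g' \<Longrightarrow> (eps h h' g g' \<noteq> eps h0 h1 g g') = (q g \<noteq> q g')"
  shows "(S h h' \<noteq> S h0 h1) = (q g \<noteq> q g0)"
  using assms(1)
proof induction
  case (step g n S g')
  then show ?case using assms(2)[OF step.hyps(2)] by argo
qed simp

text \<open>With the factors exchanged, every edge of the walk carries the cochain of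
  \<open>g0 g1\<close> up to a coboundary; only the parity of the number of steps survives.\<close>

lemma walk_accumulated:
  assumes "walk g0 g n S" "E g0 g1"
  shows "\<exists>z :: 'b \<Rightarrow> bool. \<forall>h h'. F h h' \<longrightarrow> S h h' = ((n \<and> eps h h' g0 g1) \<noteq> (z h \<noteq> z h'))"
  using assms(1)
proof induction
  case (step g n S g')
  obtain z :: "'b \<Rightarrow> bool" where z: "\<And>h h'. F h h' \<Longrightarrow> S h h' = ((n \<and> eps h h' g0 g1) \<noteq> (z h \<noteq> z h'))"
    using step.IH by blast
  obtain q :: "'b \<Rightarrow> bool" where q: "\<And>h h'. F h h' \<Longrightarrow> (eps h h' g g' \<noteq> eps h h' g0 g1) = (q h \<noteq> q h')"
    using circ_product.eps_connected[OF swapped walk_reachable[OF step.hyps(1)] assms(2) step.hyps(2)]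
      eps_swapped step.hyps(2) assms(2) by (metis (no_types, lifting))
  have "(S h h' \<noteq> eps h h' g g') =
      ((\<not> n \<and> eps h h' g0 g1) \<noteq> ((z h \<noteq> q h) \<noteq> (z h' \<noteq> q h')))" if "F h h'" for h h'
    using z[OF that] q[OF that] by argo
  then show ?case by (intro exI[of _ "\<lambda>h. z h \<noteq> q h"] allI impI)
qed (intro exI[of _ "\<lambda>_. False"], simp)

theorem connected_multiplicative:
  "(\<exists>x. \<forall>g g'. E\<^sup>*\<^sup>* g0 g \<longrightarrow> E g g' \<longrightarrow> circ (x g) (x g')) \<or>
   (\<exists>x. \<forall>h h'. F\<^sup>*\<^sup>* h0 h \<longrightarrow> F h h' \<longrightarrow> circ (x h) (x h'))"
proof (cases "(\<exists>g1. E g0 g1) \<and> (\<exists>h1. F h0 h1)")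
  case False
  then consider "\<And>g g'. E\<^sup>*\<^sup>* g0 g \<Longrightarrow> \<not> E g g'" | "\<And>h h'. F\<^sup>*\<^sup>* h0 h \<Longrightarrow> \<not> F h h'"
    by (metis converse_rtranclpE)
  then show ?thesis by cases simp_all
next
  case True
  then obtain g1 h1 where e: "E g0 g1" "F h0 h1" by blast
  show ?thesis
  \<comment> \<open>Two walks with a common end and different sums form a closed walk on which the
    cochain is odd.\<close>
  proof (cases "\<exists>g n n' S S'. walk g0 g n S \<and> walk g0 g n' S' \<and> S h0 h1 \<noteq> S' h0 h1")
    case True
    then obtain g n n' S S' where
      w: "walk g0 g n S" "walk g0 g n' S'" and ne: "S h0 h1 \<noteq> S' h0 h1" by blast
    obtain z :: "'b \<Rightarrow> bool" where z: "\<And>h h'. F h h' \<Longrightarrow> S h h' = ((n \<and> eps h h' g0 g1) \<noteq> (z h \<noteq> z h'))"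
      using walk_accumulated[OF w(1) e(1)] by blast
    obtain z' :: "'b \<Rightarrow> bool" where z': "\<And>h h'. F h h' \<Longrightarrow> S' h h' = ((n' \<and> eps h h' g0 g1) \<noteq> (z' h \<noteq> z' h'))"
      using walk_accumulated[OF w(2) e(1)] by blast
    define y where "y h \<longleftrightarrow> z h \<noteq> z' h" for h
    have y: "(y h' \<noteq> y h) = (\<not> (n \<noteq> n' \<and> eps h h' g0 g1))"
      if r: "F\<^sup>*\<^sup>* h0 h" "F h h'" for h h'
    proof -
      obtain q :: "'a \<Rightarrow> bool" where "\<And>g g'. E g g' \<Longrightarrow> (eps h h' g g' \<noteq> eps h0 h1 g g') = (q g \<noteq> q g')"
        using eps_connected[OF r(1) e(2) r(2)] by blast
      then have "(S h h' \<noteq> S h0 h1) = (S' h h' \<noteq> S' h0 h1)"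
        using walk_edge_independent[OF w(1)] walk_edge_independent[OF w(2)] by simp
      then show ?thesis using z[OF r(2)] z'[OF r(2)] ne unfolding y_def by argo
    qed
    show ?thesis
    proof (cases "n = n'")
      case True
      \<comment> \<open>\<open>y\<close> changes along every edge, so this component is
        bipartite.\<close>
      then have "circ (if y h then 0 else 5) (if y h' then 0 else 5)"
        if "F\<^sup>*\<^sup>* h0 h" "F h h'" for h h'
        using y[OF that] by (auto simp: circ_def)
      then show ?thesis by (intro disjI2 exI[of _ "\<lambda>h. if y h then 0 else 5"]) blast
    next
      case False
      then have "(y h' \<noteq> y h) = circ_product.eps (\<lambda>h g. f g h) g0 g1 h h'"
        if "F\<^sup>*\<^sup>* h0 h" "F h h'" for h h'
        using y[OF that] eps_swapped[OF e(1) that(2)] by simp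
      then show ?thesis
        using circ_product.coloring_if_coboundary[OF swapped e(1)] by blast
    qed
  next
    case False
    \<comment> \<open>No closed walk is odd, so the sum along any walk from \<open>g0\<close> is a
      potential.\<close>
    define y where "y g \<longleftrightarrow> (\<exists>n S. walk g0 g n S \<and> S h0 h1)" for g
    have y: "y g = S h0 h1" if "walk g0 g n S" for g n S
      using False that unfolding y_def by blast
    have "(y g' \<noteq> y g) = eps h0 h1 g g'" if r: "E\<^sup>*\<^sup>* g0 g" "E g g'" for g g'
    proof -
      obtain n S where w: "walk g0 g n S" using walk_exists[OF r(1)] by blast
      show ?thesis using y[OF w] y[OF walk.step[OF w r(2)]] by argo
    qed
    then show ?thesis using coloring_if_coboundary[OF e(2)] by blast
  qed
qed

end

lemma circ_coloring_if_components:
  assumes sym: "\<And>g g'. E g g' \<Longrightarrow> E g' g"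
    and comp: "\<And>g0. \<exists>x. \<forall>g g'. E\<^sup>*\<^sup>* g0 g \<longrightarrow> E g g' \<longrightarrow> circ (x g) (x g')"
  shows "\<exists>x. \<forall>g g'. E g g' \<longrightarrow> circ (x g) (x g')"
proof -
  obtain X where X: "\<And>g0 g g'. E\<^sup>*\<^sup>* g0 g \<Longrightarrow> E g g' \<Longrightarrow> circ (X g0 g) (X g0 g')"
    using comp by metis
  \<comment> \<open>Adjacent vertices satisfy the same reachability predicate, so choice gives both
    the same root.\<close>
  define root where "root g = (SOME g0. E\<^sup>*\<^sup>* g0 g)" for g
  have r: "E\<^sup>*\<^sup>* (root g) g" for g
    unfolding root_def by (rule someI[of _ g]) simp
  have "root g = root g'" if "E g g'" for g g'
  proof -
    have "E\<^sup>*\<^sup>* k g = E\<^sup>*\<^sup>* k g'" for k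
      using that sym by (meson rtranclp.rtrancl_into_rtrancl)
    then show ?thesis unfolding root_def by simp
  qed
  then have "circ (X (root g) g) (X (root g') g')" if "E g g'" for g g'
    using X[OF r that] that by metis
  then show ?thesis by (intro exI[of _ "\<lambda>g. X (root g) g"]) blast
qed

theorem circ_multiplicative:
  assumes "\<And>g g'. E g g' \<Longrightarrow> E g' g" "\<And>h h'. F h h' \<Longrightarrow> F h' h"
    and "\<And>g g' h h'. E g g' \<Longrightarrow> F h h' \<Longrightarrow> circ (f g h) (f g' h')"
  shows "(\<exists>x. \<forall>g g'. E g g' \<longrightarrow> circ (x g) (x g')) \<or> (\<exists>x. \<forall>h h'. F h h' \<longrightarrow> circ (x h) (x h'))"
proof -
  interpret circ_product E F f by unfold_locales (use assms in blast)+
  show ?thesis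
    using connected_multiplicative circ_coloring_if_components[of E] circ_coloring_if_components[of F]
      symE symF by metis
qed

section \<open>Homomorphisms and chromatic Ramsey numbers\<close>

definition circ_colorable :: "'a ugraph \<Rightarrow> bool" where
  "circ_colorable G \<longleftrightarrow> (\<exists>x. \<forall>u v. {u, v} \<in> edges G \<longrightarrow> circ (x u) (x v))"

lemma circ_colorableI:
  "(\<And>u v. {u, v} \<in> edges G \<Longrightarrow> circ (x u) (x v)) \<Longrightarrow> circ_colorable G"
  unfolding circ_colorable_def by (intro exI[of _ x] allI impI)

definition graph_hom :: "('a \<Rightarrow> 'b) \<Rightarrow> 'a ugraph \<Rightarrow> 'b ugraph \<Rightarrow> bool" where
  "graph_hom f G H \<longleftrightarrow>
     f ` verts G \<subseteq> verts H \<and> (\<forall>u v. {u, v} \<in> edges G \<longrightarrow> {f u, f v} \<in> edges H)"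

section \<open>Complete graphs and products\<close>

definition complete_graph :: "nat \<Rightarrow> nat ugraph" where
  "complete_graph n = \<lparr>verts = {..<n}, edges = [{..<n}]\<^bsup>2\<^esup>\<rparr>"

text \<open>The categorical product; pairs are encoded so that the vertex type stays
  \<open>nat\<close> under iteration.\<close>

definition graph_product :: "nat ugraph \<Rightarrow> nat ugraph \<Rightarrow> nat ugraph" where
  "graph_product G H = \<lparr>verts = prod_encode ` (verts G \<times> verts H),
     edges = {{prod_encode (g, h), prod_encode (g', h')} | g h g' h'.
       {g, g'} \<in> edges G \<and> {h, h'} \<in> edges H}\<rparr>"

lemma edge_in_verts:
  assumes "finite_simple_graph G" "{u, v} \<in> edges G"
  shows "u \<in> verts G" "v \<in> verts G" "u \<noteq> v"
proof -
  have "{u, v} \<in> [verts G]\<^bsup>2\<^esup>" using assms unfolding finite_simple_graph_def by blast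
  then show "u \<in> verts G" "v \<in> verts G" "u \<noteq> v" by simp_all
qed

lemma graph_hom_comp: "graph_hom f G H \<Longrightarrow> graph_hom g H K \<Longrightarrow> graph_hom (g \<circ> f) G K"
  unfolding graph_hom_def by fastforce

lemma edge_graph_product:
  "{u, v} \<in> edges (graph_product G H) \<longleftrightarrow>
     {fst (prod_decode u), fst (prod_decode v)} \<in> edges G \<and>
     {snd (prod_decode u), snd (prod_decode v)} \<in> edges H" (is "?L \<longleftrightarrow> ?R")
proof
  assume ?L
  then show ?R by (auto simp: graph_product_def doubleton_eq_iff insert_commute)
next
  assume r: ?R
  show ?L unfolding graph_product_def ugraph.simps mem_Collect_eq
    by (intro exI[of _ "fst (prod_decode u)"] exI[of _ "snd (prod_decode u)"]
        exI[of _ "fst (prod_decode v)"] exI[of _ "snd (prod_decode v)"]) (simp add: r)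
qed

lemma finite_simple_graph_product:
  assumes "finite_simple_graph G" "finite_simple_graph H"
  shows "finite_simple_graph (graph_product G H)"
proof -
  have "edges (graph_product G H) \<subseteq> [verts (graph_product G H)]\<^bsup>2\<^esup>"
    using edge_in_verts[OF assms(1)] edge_in_verts[OF assms(2)]
    by (fastforce simp: graph_product_def)
  then show ?thesis using assms by (simp add: finite_simple_graph_def graph_product_def)
qed

lemma graph_hom_product:
  "graph_hom (fst \<circ> prod_decode) (graph_product G H) G"
  "graph_hom (snd \<circ> prod_decode) (graph_product G H) H"
  by (auto simp: graph_hom_def edge_graph_product) (auto simp: graph_product_def)

lemma circ_colorable_product:
  assumes "circ_colorable (graph_product G H)"
  shows "circ_colorable G \<or> circ_colorable H"
proof -
  obtain x where x: "\<And>u v. {u, v} \<in> edges (graph_product G H) \<Longrightarrow> circ (x u) (x v)"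
    using assms unfolding circ_colorable_def by blast
  show ?thesis unfolding circ_colorable_def
    by (rule circ_multiplicative[where f = "\<lambda>g h. x (prod_encode (g, h))"])
      (auto intro: x simp: edge_graph_product insert_commute)
qed

lemma finite_simple_complete_graph: "finite_simple_graph (complete_graph n)"
  by (simp add: finite_simple_graph_def complete_graph_def)

lemma complete_graph_4_not_circ_colorable: "\<not> circ_colorable (complete_graph 4)"
proof
  assume "circ_colorable (complete_graph 4)"
  then obtain x where x: "\<And>u v :: nat. {u, v} \<in> [{..<4}]\<^bsup>2\<^esup> \<Longrightarrow> circ (x u) (x v)"
    unfolding circ_colorable_def complete_graph_def ugraph.simps by blast
  have "circ (x u) (x v)" if "u < 4" "v < 4" "u \<noteq> v" for u v
    using x[of u v] that by simp
  then show False using circ_no_4_clique[of "x 0" "x 1" "x 2" "x 3"] by simp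
qed

text \<open>An iterated product, started at \<open>complete_graph 4\<close>: multiplicativity keeps
  it non-colourable, and the projections are the maps \<open>f\<close>.\<close>

lemma common_not_circ_colorable:
  fixes \<G> :: "nat ugraph set"
  assumes "finite \<G>" "\<And>H. H \<in> \<G> \<Longrightarrow> finite_simple_graph H \<and> \<not> circ_colorable H"
  shows "\<exists>P :: nat ugraph. finite_simple_graph P \<and> \<not> circ_colorable P \<and>
    (\<forall>H\<in>\<G>. \<exists>f. graph_hom f P H)"
  using assms
proof (induction \<G>)
  case empty
  then show ?case
    using complete_graph_4_not_circ_colorable
    by (intro exI[of _ "complete_graph 4"]) (simp add: finite_simple_complete_graph)
next
  case (insert H \<G>)
  then obtain P :: "nat ugraph" where P: "finite_simple_graph P" "\<not> circ_colorable P"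
    "\<And>K. K \<in> \<G> \<Longrightarrow> \<exists>f. graph_hom f P K" by auto
  have H: "finite_simple_graph H" "\<not> circ_colorable H" using insert.prems by auto
  show ?case
  proof (intro exI[of _ "graph_product P H"] conjI ballI)
    show "finite_simple_graph (graph_product P H)"
      by (rule finite_simple_graph_product[OF P(1) H(1)])
    show "\<not> circ_colorable (graph_product P H)"
      using circ_colorable_product P(2) H(2) by blast
    fix K assume "K \<in> insert H \<G>"
    then show "\<exists>f. graph_hom f (graph_product P H) K"
      using graph_hom_product(2) graph_hom_comp[OF graph_hom_product(1)] P(3) by blast
  qed
qed

section \<open>Two-coloured complete graphs\<close>

lemma no_two_circ_colorings:
  assumes "card V > 10" and "\<And>u. x u < 10"
    and cov: "\<And>u v. u \<in> V \<Longrightarrow> v \<in> V \<Longrightarrow> u \<noteq> v \<Longrightarrow> circ (x u) (x v) \<or> circ (y u) (y v)"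
  shows False
proof -
  have fin: "finite V" using assms(1) card.infinite by fastforce
  \<comment> \<open>Each vertex is counted in 3 of the 10 windows, so more than 10 vertices force 4
    into some window.\<close>
  have "(\<Sum>t<10. card {u \<in> V. x u \<in> circ_window t}) = (\<Sum>t<10. \<Sum>u\<in>V. of_bool (x u \<in> circ_window t))"
    by (simp add: fin Int_def)
  also have "\<dots> = (\<Sum>u\<in>V. \<Sum>t<10. of_bool (x u \<in> circ_window t))" by (rule sum.swap)
  also have "\<dots> = 3 * card V" using sum_circ_window assms(2) by simp
  finally have s: "(\<Sum>t<10. card {u \<in> V. x u \<in> circ_window t}) = 3 * card V" .
  obtain t where t: "t < 10" "card {u \<in> V. x u \<in> circ_window t} \<ge> 4"
  proof (rule ccontr)
    assume "\<not> thesis"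
    then have "\<forall>t<10. card {u \<in> V. x u \<in> circ_window t} \<le> 3" using that by fastforce
    then have "(\<Sum>t<10. card {u \<in> V. x u \<in> circ_window t}) \<le> (\<Sum>t<(10::nat). 3)"
      by (intro sum_mono) simp
    then show False using s assms(1) by simp
  qed
  obtain S where S: "S \<subseteq> {u \<in> V. x u \<in> circ_window t}" "card S = 4"
    using obtain_subset_with_card_n[OF t(2)] by metis
  obtain a b c d where "S = {a, b, c, d}" "distinct [a, b, c, d]"
    using S(2) by (auto simp: card_Suc_eq numeral_eq_Suc)
  moreover have "circ (y u) (y v)" if "u \<in> S" "v \<in> S" "u \<noteq> v" for u v
    using cov[of u v] circ_window_independent[OF t(1), of "x u" "x v"] S(1) that by blast
  ultimately show False using circ_no_4_clique[of "y a" "y b" "y c" "y d"] by simp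
qed

section \<open>The lower bound\<close>

lemma proper_coloring_chromatic_number:
  assumes "finite_simple_graph F"
  shows "\<exists>k. proper_coloring F (chromatic_number F) k"
proof -
  obtain k :: "'a \<Rightarrow> nat" where "bij_betw k (verts F) {0..<card (verts F)}"
    using assms ex_bij_betw_finite_nat unfolding finite_simple_graph_def by blast
  then have "proper_coloring F (card (verts F)) k"
    using edge_in_verts[OF assms]
    unfolding proper_coloring_def bij_betw_def inj_on_def by (metis lessThan_atLeast0 order_refl)
  then have "{n. \<exists>k. proper_coloring F n k} \<noteq> {}" by blast
  from Inf_nat_def1[OF this] show ?thesis unfolding chromatic_number_def by blast
qed

text \<open>A proper colouring \<open>k\<close> with values below 10 pulls back a 2-colouring of
  pairs of residues: a copy of \<open>G\<close> in one class maps to the circular clique by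
  \<open>k\<close>, in the other by \<open>3 * k\<close> modulo 10.\<close>

lemma chromatic_number_if_arrows:
  assumes G: "finite_simple_graph G" "\<not> circ_colorable G"
    and F: "finite_simple_graph F" "ramsey_arrows F G"
  shows "chromatic_number F > 10"
proof (rule ccontr)
  assume small: "\<not> chromatic_number F > 10"
  obtain k where "proper_coloring F (chromatic_number F) k"
    using proper_coloring_chromatic_number[OF F(1)] by blast
  then have k: "\<And>u. u \<in> verts F \<Longrightarrow> k u < 10" "\<And>u v. {u, v} \<in> edges F \<Longrightarrow> k u \<noteq> k v"
    using small unfolding proper_coloring_def by auto
  define c where "c e \<longleftrightarrow> (\<exists>u v. e = {u, v} \<and> circ (k u) (k v))" for e
  have c: "c {u, v} \<longleftrightarrow> circ (k u) (k v)" for u v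
    unfolding c_def using circ_sym by (metis doubleton_eq_iff)
  obtain H where H: "copy_of G H" "subgraph_of H F" "monochromatic c H"
    using F(2) unfolding ramsey_arrows_def by blast
  obtain f where f: "edges H = (\<lambda>e. f ` e) ` edges G"
    using H(1) unfolding copy_of_def by blast
  have e: "{f u, f v} \<in> edges H" if "{u, v} \<in> edges G" for u v
    using that unfolding f by (auto intro!: image_eqI[of _ _ "{u, v}"])
  then have eF: "{f u, f v} \<in> edges F" if "{u, v} \<in> edges G" for u v
    using that H(2) unfolding subgraph_of_def by blast
  obtain b where b: "\<And>e. e \<in> edges H \<Longrightarrow> c e = b"
    using H(3) unfolding monochromatic_def by blast
  have "circ_colorable G"
  proof (cases b)
    case True
    then show ?thesis unfolding circ_colorable_def
      using e b c by (intro exI[of _ "k \<circ> f"]) (metis comp_apply)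
  next
    case False
    have "circ (3 * k (f u) mod 10) (3 * k (f v) mod 10)" if "{u, v} \<in> edges G" for u v
      using circ_times_3 k edge_in_verts[OF F(1) eF[OF that]] eF[OF that] b[OF e[OF that]] c False
      by auto
    then show ?thesis by (rule circ_colorableI)
  qed
  then show False using G(2) by blast
qed

section \<open>The upper bound\<close>

lemma exists_arrowing_graph:
  fixes G :: "nat ugraph"
  assumes "m > 0" and G: "finite_simple_graph G"
    and hom: "\<And>d :: nat \<Rightarrow> nat \<Rightarrow> bool. \<exists>b p. p ` verts G \<subseteq> {..<m} \<and>
      (\<forall>u v. {u, v} \<in> edges G \<longrightarrow> p u \<noteq> p v \<and> (p u < p v \<longrightarrow> d (p u) (p v) = b))"
  shows "\<exists>F :: nat ugraph. finite_simple_graph F \<and> (\<exists>k. proper_coloring F m k) \<and> ramsey_arrows F G"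
proof -
  obtain n where n: "verts G \<subseteq> {..<n}"
    using G finite_nat_iff_bounded unfolding finite_simple_graph_def by blast
  let ?Q = "{..<m} \<times> {..<m}"
  define K where "K = card (Pow ?Q)"
  obtain code where code: "bij_betw code (Pow ?Q) {..<K}"
    using ex_bij_betw_finite_nat[of "Pow ?Q"] unfolding K_def by (auto simp: atLeast0LessThan)
  \<comment> \<open>One Ramsey colour per pattern; \<open>m * n\<close> positions give each of the
    \<open>m\<close> parts its own block of \<open>n\<close>, enough for every vertex label of
    \<open>G\<close>.\<close>
  obtain N :: nat where N: "partn_lst {..<N} (replicate K (m * n)) 2" using ramsey_full by blast
  (* The vertex m * x + i lies in part i at position x. Ramsey's theorem is applied to positions, a
     pair x < y being coloured by the whole pattern of colours between the vertices over x and y. *)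
  define F :: "nat ugraph" where "F = \<lparr>verts = {..<m * N},
    edges = {{a, b} | a b. a < m * N \<and> b < m * N \<and> a mod m \<noteq> b mod m}\<rparr>"
  have "finite_simple_graph F" by (auto simp: F_def finite_simple_graph_def)
  moreover have "proper_coloring F m (\<lambda>a. a mod m)"
    using assms(1) by (auto simp: proper_coloring_def F_def doubleton_eq_iff)
  moreover have "ramsey_arrows F G"
    unfolding ramsey_arrows_def
  proof
    fix c :: "nat set \<Rightarrow> bool"
    define pat where "pat e = {(i, j) \<in> ?Q. c {m * Min e + i, m * Max e + j}}" for e
    have "(\<lambda>e. code (pat e)) \<in> [{..<N}]\<^bsup>2\<^esup> \<rightarrow> {..<K}"
      using code by (auto simp: bij_betw_def pat_def)
    then obtain l Y where l: "l < K" and Y: "Y \<in> [{..<N}]\<^bsup>(m * n)\<^esup>" "(\<lambda>e. code (pat e)) ` [Y]\<^bsup>2\<^esup> \<subseteq> {l}"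
      using partn_lstE[OF N, of _ K] by (metis length_replicate nth_replicate)
    obtain T where T: "T \<in> Pow ?Q" "code T = l" using code l unfolding bij_betw_def by (metis imageE lessThan_iff)
    have pat: "pat e = T" if "e \<in> [Y]\<^bsup>2\<^esup>" for e
    proof (rule inj_onD[OF bij_betw_imp_inj_on[OF code]])
      show "code (pat e) = code T" using Y(2) that T by auto
      show "pat e \<in> Pow ?Q" "T \<in> Pow ?Q" using T by (auto simp: pat_def)
    qed
    define pos where "pos i = sorted_list_of_set Y ! i" for i
    have Yf: "finite Y" "card Y = m * n" "Y \<subseteq> {..<N}" using Y(1) by (auto simp: nsets_def)
    have pos_less: "pos i < pos j" if "i < j" "j < m * n" for i j
      using that Yf unfolding pos_def by (simp add: sorted_wrt_nth_less)
    have pos_in: "pos i \<in> Y" if "i < m * n" for i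
      using that Yf unfolding pos_def by (metis length_sorted_list_of_set nth_mem set_sorted_list_of_set)
    have pos_inj: "i = j" if "pos i = pos j" "i < m * n" "j < m * n" for i j
      using pos_less that by (metis less_irrefl linorder_neqE_nat)
    \<comment> \<open>The uniform pattern, read for \<open>i < j\<close>, is a 2-colouring of the
      complete graph on \<open>m\<close> vertices.\<close>
    obtain b p where bp: "p ` verts G \<subseteq> {..<m} \<and> (\<forall>u v. {u, v} \<in> edges G \<longrightarrow>
        p u \<noteq> p v \<and> (p u < p v \<longrightarrow> ((p u, p v) \<in> T) = b))"
      using hom[of "\<lambda>i j. (i, j) \<in> T"] by (elim exE)
    have p: "\<And>u. u \<in> verts G \<Longrightarrow> p u < m"
      "\<And>u v. {u, v} \<in> edges G \<Longrightarrow> p u \<noteq> p v"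
      "\<And>u v. {u, v} \<in> edges G \<Longrightarrow> p u < p v \<Longrightarrow> ((p u, p v) \<in> T) = b"
      using bp by auto
    (* Part i only uses positions of the i-th block, so the pattern T decides all colours. *)
    define ix where "ix u = p u * n + u" for u
    have ix_mono: "ix u < ix v" if "u \<in> verts G" "p u < p v" for u v
    proof -
      have "p u * n + u < Suc (p u) * n" using n that by auto
      also have "\<dots> \<le> p v * n" using that by (intro mult_le_mono1) simp
      finally show ?thesis unfolding ix_def by simp
    qed
    have ix_less: "ix u < m * n" if "u \<in> verts G" for u
    proof -
      have "p u * n + u < Suc (p u) * n" using n that by auto
      also have "\<dots> \<le> m * n" using p(1)[OF that] by (intro mult_le_mono1) simp
      finally show ?thesis unfolding ix_def .
    qed
    define f where "f u = m * pos (ix u) + p u" for u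
    have fm: "f u mod m = p u" "f u div m = pos (ix u)" if "u \<in> verts G" for u
      using p(1)[OF that] assms(1) unfolding f_def by simp_all
    have f_less: "f u < m * N" if "u \<in> verts G" for u
    proof -
      have "pos (ix u) < N" using pos_in[OF ix_less[OF that]] Yf by blast
      then have "m * Suc (pos (ix u)) \<le> m * N" by (intro mult_le_mono2) simp
      then show ?thesis unfolding f_def using p(1)[OF that] by simp
    qed
    have inj: "inj_on f (verts G)"
    proof (rule inj_onI)
      fix u v assume uv: "u \<in> verts G" "v \<in> verts G" "f u = f v"
      then have "p u = p v" "ix u = ix v" using fm pos_inj ix_less by metis+
      then show "u = v" unfolding ix_def by simp
    qed
    have mono: "c {f u, f v} = b" if e: "{u, v} \<in> edges G" and less: "p u < p v" for u v
    proof -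
      have uv: "u \<in> verts G" "v \<in> verts G" using edge_in_verts[OF G e] by simp_all
      have lt: "pos (ix u) < pos (ix v)" using pos_less ix_mono ix_less uv less by blast
      then have "pat {pos (ix u), pos (ix v)} = T"
        using pos_in ix_less uv by (intro pat) simp
      moreover have "c {f u, f v} \<longleftrightarrow> (p u, p v) \<in> pat {pos (ix u), pos (ix v)}"
        using lt p(1) uv unfolding pat_def f_def by simp
      ultimately show ?thesis using p(3)[OF e less] by simp
    qed
    define H where "H = \<lparr>verts = f ` verts G, edges = (\<lambda>e. f ` e) ` edges G\<rparr>"
    have edge: "f ` e \<in> edges F \<and> c (f ` e) = b" if "e \<in> edges G" for e
    proof -
      have "e \<in> [verts G]\<^bsup>2\<^esup>" using that G unfolding finite_simple_graph_def by blast
      then obtain u v where uv: "e = {u, v}" by (auto simp: nsets_2_eq)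
      have in_G: "u \<in> verts G" "v \<in> verts G" using edge_in_verts[OF G] that uv by auto
      have ne: "p u \<noteq> p v" using p(2) that uv by blast
      then have "{f u, f v} \<in> edges F" using f_less fm(1) in_G
        unfolding F_def ugraph.simps mem_Collect_eq by (intro exI[of _ "f u"] exI[of _ "f v"]) simp
      moreover have "c {f u, f v} = b"
        using mono[of u v] mono[of v u] that uv ne by (metis insert_commute linorder_neqE_nat)
      ultimately show ?thesis using uv by simp
    qed
    show "\<exists>H. copy_of G H \<and> subgraph_of H F \<and> monochromatic c H"
    proof (intro exI[of _ H] conjI)
      show "copy_of G H" using inj unfolding copy_of_def H_def by auto
      show "subgraph_of H F" using edge f_less unfolding subgraph_of_def H_def by (auto simp: F_def)
      show "monochromatic c H" using edge unfolding monochromatic_def H_def by auto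
    qed
  qed
  ultimately show ?thesis by blast
qed

section \<open>Chromatic number 4 and conclusion\<close>

lemma chromatic_number_eq_4:
  assumes "finite_simple_graph G" "\<not> circ_colorable G" "graph_hom f G (complete_graph 4)"
  shows "chromatic_number G = 4"
  unfolding chromatic_number_def
proof (rule cInf_eq_minimum)
  have "f u \<noteq> f v" if "{u, v} \<in> edges G" for u v
  proof -
    have "{f u, f v} \<in> edges (complete_graph 4)" using assms(3) that unfolding graph_hom_def by blast
    then show ?thesis by (rule edge_in_verts(3)[OF finite_simple_complete_graph])
  qed
  moreover have "f ` verts G \<subseteq> {..<4}" using assms(3) by (simp add: graph_hom_def complete_graph_def)
  ultimately show "4 \<in> {k. \<exists>f. proper_coloring G k f}" unfolding proper_coloring_def by blast
next
  fix k assume "k \<in> {k. \<exists>f. proper_coloring G k f}"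
  then obtain g where g: "proper_coloring G k g" by blast
  show "4 \<le> k"
  proof (rule ccontr)
    assume "\<not> 4 \<le> k"
    then have less: "g u < 3" if "u \<in> verts G" for u
      using g that unfolding proper_coloring_def by fastforce
    \<comment> \<open>A 3-colouring would map \<open>G\<close> to the triangle 0, 3, 6.\<close>
    have "circ (3 * g u) (3 * g v)" if e: "{u, v} \<in> edges G" for u v
    proof -
      have "g u < 3" "g v < 3" using less edge_in_verts[OF assms(1) e] by simp_all
      moreover have "g u \<noteq> g v" using g e unfolding proper_coloring_def by blast
      ultimately show ?thesis unfolding circ_def by linarith
    qed
    then show False using assms(2) circ_colorableI[of G "\<lambda>u. 3 * g u"] by blast
  qed
qed

theorem theorem1p2:
  "\<exists>G :: nat ugraph. finite_simple_graph G \<and> chromatic_number G = 4 \<and>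
     chromatic_ramsey_number G = 11"
proof -
  \<comment> \<open>The graphs on \<open>{..<11}\<close> cover a class of every 2-colouring;
    \<open>complete_graph 4\<close> bounds the chromatic number.\<close>
  define \<G> where "\<G> = insert (complete_graph 4)
    {H :: nat ugraph. finite_simple_graph H \<and> verts H = {..<11} \<and> \<not> circ_colorable H}"
  have "{H :: nat ugraph. finite_simple_graph H \<and> verts H = {..<11} \<and> \<not> circ_colorable H}
      \<subseteq> (\<lambda>E. \<lparr>verts = {..<11}, edges = E\<rparr>) ` Pow ([{..<11}]\<^bsup>2\<^esup>)"
  proof
    fix H :: "nat ugraph"
    assume "H \<in> {H. finite_simple_graph H \<and> verts H = {..<11} \<and> \<not> circ_colorable H}"
    then have "H = \<lparr>verts = {..<11}, edges = edges H\<rparr>" "edges H \<in> Pow ([{..<11}]\<^bsup>2\<^esup>)"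
      by (auto simp: finite_simple_graph_def)
    then show "H \<in> (\<lambda>E. \<lparr>verts = {..<11}, edges = E\<rparr>) ` Pow ([{..<11}]\<^bsup>2\<^esup>)" by (rule image_eqI)
  qed
  moreover have "finite ([{..<11::nat}]\<^bsup>2\<^esup>)" by (simp add: finite_imp_finite_nsets)
  ultimately have "finite \<G>" unfolding \<G>_def by (simp add: finite_subset)
  moreover have "finite_simple_graph H \<and> \<not> circ_colorable H" if "H \<in> \<G>" for H
    using that finite_simple_complete_graph complete_graph_4_not_circ_colorable
    unfolding \<G>_def by blast
  ultimately obtain G :: "nat ugraph" where G: "finite_simple_graph G" "\<not> circ_colorable G"
    and hom: "\<And>H. H \<in> \<G> \<Longrightarrow> \<exists>f. graph_hom f G H"
    using common_not_circ_colorable[of \<G>] by metis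
  have chi: "chromatic_number G = 4"
    using chromatic_number_eq_4[OF G] hom[of "complete_graph 4"] unfolding \<G>_def by blast
  have cols: "\<exists>b p. p ` verts G \<subseteq> {..<11} \<and>
      (\<forall>u v. {u, v} \<in> edges G \<longrightarrow> p u \<noteq> p v \<and> (p u < p v \<longrightarrow> d (p u) (p v) = b))"
    for d :: "nat \<Rightarrow> nat \<Rightarrow> bool"
  proof -
    define C where "C b = \<lparr>verts = {..<11}, edges = {{i, j} | i j. i < j \<and> j < 11 \<and> d i j = b}\<rparr>" for b
    have edge: "{i, j} \<in> edges (C b) \<longleftrightarrow> d i j = b" if "i < j" "j < 11" for i j b
      using that by (auto simp: C_def doubleton_eq_iff)
    have fs: "finite_simple_graph (C b)" for b
      by (auto simp: C_def finite_simple_graph_def)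
    obtain b where "\<not> circ_colorable (C b)"
    proof (rule ccontr)
      assume "\<not> thesis"
      then have "circ_colorable (C True)" "circ_colorable (C False)" using that by blast+
      then obtain x y where x: "\<And>u v. {u, v} \<in> edges (C True) \<Longrightarrow> circ (x u) (x v)"
        and y: "\<And>u v. {u, v} \<in> edges (C False) \<Longrightarrow> circ (y u) (y v)"
        unfolding circ_colorable_def by blast
      \<comment> \<open>\<open>circ_colorable\<close> leaves isolated vertices free; reduction
        modulo 10 bounds their values and changes no edge.\<close>
      have xm: "circ (x u mod 10) (x v mod 10)" if "circ (x u) (x v)" for u v
        using that by (simp add: circ_def)
      have less: "circ (x i mod 10) (x j mod 10) \<or> circ (y i) (y j)" if "i < j" "j < 11" for i j
        using edge[OF that] x y xm by metis
      have "circ (x u mod 10) (x v mod 10) \<or> circ (y u) (y v)"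
        if "u \<in> {..<11}" "v \<in> {..<11}" "u \<noteq> v" for u v
        using less[of u v] less[of v u] that circ_sym by (metis lessThan_iff linorder_neqE_nat)
      then show False using no_two_circ_colorings[of "{..<11}" "\<lambda>u. x u mod 10" y] by simp
    qed
    then have "C b \<in> \<G>" using fs unfolding \<G>_def by (simp add: C_def)
    then obtain p where p: "graph_hom p G (C b)" using hom by blast
    have "p u \<noteq> p v \<and> (p u < p v \<longrightarrow> d (p u) (p v) = b)" if "{u, v} \<in> edges G" for u v
    proof -
      have e: "{p u, p v} \<in> edges (C b)" using p that unfolding graph_hom_def by blast
      then show ?thesis using edge_in_verts[OF fs e] edge[of "p u" "p v" b] by (auto simp: C_def)
    qed
    moreover have "p ` verts G \<subseteq> {..<11}" using p by (simp add: graph_hom_def C_def)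
    ultimately show ?thesis by blast
  qed
  obtain F :: "nat ugraph" and k where F: "finite_simple_graph F" "proper_coloring F 11 k" "ramsey_arrows F G"
    using exists_arrowing_graph[OF zero_less_numeral G(1) cols] by blast
  have "chromatic_number F \<le> 11"
    using F(2) unfolding chromatic_number_def by (intro cInf_lower) auto
  then have "chromatic_number F = 11" using chromatic_number_if_arrows[OF G F(1,3)] by simp
  \<comment> \<open>The value is attained at \<open>F\<close>, so it is not the default 0 of an
    empty infimum.\<close>
  then have "chromatic_ramsey_number G = 11"
    unfolding chromatic_ramsey_number_def
    using F chromatic_number_if_arrows[OF G] by (intro cInf_eq_minimum) fastforce+
  then show ?thesis using G(1) chi by blast
qed

end
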